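(* Let $U\in O(N)$ be circulant and symmetric with all entries nonzero. Write $U_{ij}=\gamma_{j-i}$, with indices taken modulo $N$ in $\{0,\dots,N-1\}$. Let $e\in\{0,1\}$ be the parity of $N$: $e=1$ if $N$ is odd and $e=0$ if $N$ is even. Then $$\mathbb E(\Phi(U,B))=N\sum_i|\gamma_i|-\left(\frac{1}{|\gamma_0|}+\frac{1-e}{|\gamma_{N/2}|}+\frac{N-2+e}{N}\sum_i\frac{1}{|\gamma_i|}\right).$$ Here $\mathbb E$ is the expectation with respect to the uniform probability measure on the finite set of real $N\times N$ circulant symmetric orthogonal matrices $B$. When $N$ is odd, the term involving $\gamma_{N/2}$ is absent.
   Context: Let $U\in U(N)$ have all entries nonzero. Define $S_{ij}=U_{ij}/|U_{ij}|$ and $X=S^*U$. For a hermitian matrix $B$ define $$\Phi(U,B)=\mathrm{Tr}(XB^2)-\sum_{i,j}\frac{\mathrm{Re}\left[(UB)_{ij}\overline{S_{ij}}\right]^2}{|U_{ij}|}.$$ A matrix is circulant if its $(i,j)$ entry depends only on $j-i$ modulo $N$. *)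

theory Defs
  imports "HOL-Probability.Probability" "Jordan_Normal_Form.Schur_Decomposition"
begin

definition mat_trace :: "'a::comm_monoid_add mat \<Rightarrow> 'a" where
  "mat_trace A = (\<Sum>i<dim_row A. A $$ (i, i))"

(* The constant orthogonal_mat of Jordan_Normal_Form only asks for pairwise orthogonal nonzero
   columns, hence a separate set O(N). *)
definition orthogonal_group :: "nat \<Rightarrow> real mat set" where
  "orthogonal_group N =
     {A \<in> carrier_mat N N. A * transpose_mat A = 1\<^sub>m N \<and> transpose_mat A * A = 1\<^sub>m N}"

definition circulant_mat :: "nat \<Rightarrow> 'a mat \<Rightarrow> bool" where
  "circulant_mat N A \<longleftrightarrow> A \<in> carrier_mat N N \<and>
     (\<forall>i<N. \<forall>j<N. \<forall>k<N. \<forall>l<N.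
        (int j - int i) mod int N = (int l - int k) mod int N \<longrightarrow> A $$ (i, j) = A $$ (k, l))"

definition symm_mat :: "'a mat \<Rightarrow> bool" where
  "symm_mat A \<longleftrightarrow> transpose_mat A = A"

definition circ_symm_orth :: "nat \<Rightarrow> real mat set" where
  "circ_symm_orth N = {B \<in> orthogonal_group N. circulant_mat N B \<and> symm_mat B}"

definition phase_mat :: "complex mat \<Rightarrow> complex mat" where
  "phase_mat U = map_mat (\<lambda>z. z / complex_of_real (cmod z)) U"

(* Complex-valued: X = S^* U need not be hermitian for a general unitary U, so Tr(X B^2) need
   not be real. *)
definition Phi :: "complex mat \<Rightarrow> complex mat \<Rightarrow> complex" where
  "Phi U B =
     (let S = phase_mat U; X = mat_adjoint S * U in
      mat_trace (X * (B * B)) -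
      complex_of_real (\<Sum>i<dim_row U. \<Sum>j<dim_col U.
        (Re ((U * B) $$ (i, j) * cnj (S $$ (i, j))))\<^sup>2 / cmod (U $$ (i, j))))"

end

theory Submission
  imports Defs
begin

text \<open>
  The discrete Fourier transform identifies the symmetric circulant orthogonal matrices of size
  \<open>N\<close> with the group of even functions \<open>\<epsilon>\<close> from the integers modulo \<open>N\<close> to \<open>{1, -1}\<close>, matrix
  product corresponding to pointwise product. As \<open>U\<close> belongs to this group, \<open>U * B\<close> is distributed
  like \<open>B\<close>, and as \<open>B * B\<close> is the identity, only the second moments of the entries of \<open>B\<close> are
  needed. They follow from the correlations of the signs: the expectation of \<open>\<epsilon> m * \<epsilon> n\<close> is 1 if
  \<open>n \<equiv> \<plusminus>m\<close> modulo \<open>N\<close> and 0 otherwise.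
\<close>

context
  fixes N :: nat
  assumes N_pos: "N > 0"
begin

section \<open>Sums over the residues modulo \<open>N\<close>\<close>

definition periodic :: "(int \<Rightarrow> 'a) \<Rightarrow> bool" where
  "periodic f \<longleftrightarrow> (\<forall>k. f (k mod int N) = f k)"

lemma periodic_mod: "periodic f \<Longrightarrow> f (k mod int N) = f k"
  by (simp add: periodic_def)

lemma periodic_cong: "periodic f \<Longrightarrow> a mod int N = b mod int N \<Longrightarrow> f a = f b"
  by (metis periodic_def)

lemma periodicI: "(\<And>a b. a mod int N = b mod int N \<Longrightarrow> f a = f b) \<Longrightarrow> periodic f"
  unfolding periodic_def by (metis mod_mod_trivial)

lemma dvd_diff_iff_eq:
  assumes "i < N" "j < N"
  shows "int N dvd int i - int j \<longleftrightarrow> i = j"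
  using assms by (simp flip: mod_eq_dvd_iff)

text \<open>Reducing \<open>a - i\<close> modulo \<open>N\<close> is an involution of
  \<open>{..<N}\<close>, so the reindexing map is its own inverse.\<close>

lemma sum_periodic_reflect:
  fixes f :: "int \<Rightarrow> 'a::comm_monoid_add"
  assumes f: "periodic f"
  shows "(\<Sum>i<N. f (a - int i)) = (\<Sum>i<N. f (int i))"
proof -
  define r where "r i = nat ((a - int i) mod int N)" for i
  have int_r: "int (r i) = (a - int i) mod int N" for i
    using N_pos by (simp add: r_def)
  have r_less: "r i < N" for i
    using N_pos by (metis int_r of_nat_less_iff of_nat_0_less_iff pos_mod_bound)
  have r_r: "r (r i) = i" if "i < N" for i
  proof -
    have "int (r (r i)) = int i"
      using that by (simp add: int_r mod_diff_right_eq)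
    then show ?thesis by simp
  qed
  show ?thesis
    by (rule sum.reindex_bij_witness[of _ r r])
      (auto simp: r_r r_less int_r periodic_mod[OF f])
qed

text \<open>A translation is the composite of two reflections.\<close>

lemma sum_periodic_shift:
  fixes f :: "int \<Rightarrow> 'a::comm_monoid_add"
  assumes f: "periodic f"
  shows "(\<Sum>i<N. f (int i + a)) = (\<Sum>i<N. f (int i))"
proof -
  have "periodic (\<lambda>k. f (a - k))"
    by (rule periodicI, rule periodic_cong[OF f]) (metis mod_diff_right_eq)
  from sum_periodic_reflect[OF this, of 0] sum_periodic_reflect[OF f, of a]
  show ?thesis by (simp add: add.commute)
qed

text \<open>Exactly one index below \<open>N\<close> is congruent to \<open>a\<close>, and
  periodicity allows its value to be read off at \<open>a\<close> itself.\<close>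

lemma sum_periodic_delta:
  fixes f :: "int \<Rightarrow> 'a::comm_monoid_add"
  assumes f: "periodic f"
  shows "(\<Sum>i<N. if int N dvd int i - a then f (int i) else 0) = f a"
proof -
  let ?k = "nat (a mod int N)"
  have k: "?k < N" "int ?k = a mod int N"
    using N_pos by (simp_all add: nat_less_iff)
  have "(int N dvd int i - a) = (i = ?k)" if "i < N" for i
    using that k by (metis mod_eq_dvd_iff mod_less of_nat_eq_iff of_nat_mod)
  then have "(\<Sum>i<N. if int N dvd int i - a then f (int i) else 0) = (\<Sum>i<N. if i = ?k then f (int i) else 0)"
    by (intro sum.cong) auto
  also have "\<dots> = f (int ?k)" using k by simp
  also have "\<dots> = f a" using k f by (simp add: periodic_mod)
  finally show ?thesis .
qed

section \<open>Roots of unity and their power sums\<close>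

definition unit_root :: "int \<Rightarrow> complex" where
  "unit_root k = cis (2 * pi * of_int k / real N)"

lemma unit_root_0 [simp]: "unit_root 0 = 1"
  by (simp add: unit_root_def)

lemma unit_root_add: "unit_root (a + b) = unit_root a * unit_root b"
  by (simp add: unit_root_def cis_mult add_divide_distrib ring_distribs)

lemma cnj_unit_root: "cnj (unit_root k) = unit_root (- k)"
  by (simp add: unit_root_def cis_cnj)

lemma unit_root_eq_1_iff: "unit_root k = 1 \<longleftrightarrow> int N dvd k"
proof
  assume "unit_root k = 1"
  then have "cos (2 * pi * of_int k / real N) = 1"
    by (simp add: unit_root_def complex_eq_iff)
  then obtain n :: int where "2 * pi * of_int k / real N = of_int n * 2 * pi"
    by (auto simp: cos_one_2pi_int)
  then have "real_of_int k = real_of_int (n * int N)"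
    using N_pos by (simp add: field_simps)
  then show "int N dvd k"
    by (metis of_int_eq_iff dvd_triv_right)
next
  assume "int N dvd k"
  then obtain n where "k = int N * n" ..
  then show "unit_root k = 1"
    using N_pos cis_multiple_2pi[of "of_int n"] by (simp add: unit_root_def mult.assoc)
qed

lemma unit_root_mult_nat: "unit_root (int m * k) = unit_root k ^ m"
  by (induction m) (simp_all add: unit_root_add algebra_simps)

lemma unit_root_cong: "int N dvd a - b \<Longrightarrow> unit_root a = unit_root b"
  by (metis add.commute diff_add_cancel mult.right_neutral unit_root_add unit_root_eq_1_iff)

text \<open>Orthogonality of characters: a geometric sum whose ratio is an \<open>N\<close>-th root
  of unity, equal to 1 only in the divisible case.\<close>

lemma sum_unit_root: "(\<Sum>m<N. unit_root (int m * k)) = (if int N dvd k then of_nat N else 0)"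
proof (cases "int N dvd k")
  case True
  then have "unit_root k = 1" by (simp add: unit_root_eq_1_iff)
  then show ?thesis using True by (simp add: unit_root_mult_nat)
next
  case False
  then have "unit_root k \<noteq> 1" by (simp add: unit_root_eq_1_iff)
  moreover have "unit_root k ^ N = 1"
    by (simp add: unit_root_mult_nat[symmetric] unit_root_eq_1_iff)
  ultimately show ?thesis
    using False by (simp add: unit_root_mult_nat geometric_sum)
qed

section \<open>Sign functions and their circulant matrices\<close>

text \<open>These are the possible eigenvalue sequences. Functions on residues are represented by
  periodic functions on \<open>int\<close>, so that evenness and index arithmetic need no reduction
  modulo \<open>N\<close>.\<close>

definition sign_functions :: "(int \<Rightarrow> real) set" where
  "sign_functions = {\<epsilon>. periodic \<epsilon> \<and> (\<forall>m. \<epsilon> (- m) = \<epsilon> m) \<and> (\<forall>m. \<epsilon> m = 1 \<or> \<epsilon> m = -1)}"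

text \<open>The inverse discrete Fourier transform of \<open>\<epsilon>\<close>; thus
  \<open>\<epsilon>\<close> lists the eigenvalues of the circulant matrix built from it.\<close>

definition circ_entry :: "(int \<Rightarrow> real) \<Rightarrow> int \<Rightarrow> complex" where
  "circ_entry \<epsilon> d = (\<Sum>m<N. of_real (\<epsilon> (int m)) * unit_root (int m * d)) / of_nat N"

text \<open>Taking real parts loses nothing on sign functions, by
  \<open>of_real_circ\<close>.\<close>

definition circ :: "(int \<Rightarrow> real) \<Rightarrow> real mat" where
  "circ \<epsilon> = mat N N (\<lambda>(i, j). Re (circ_entry \<epsilon> (int j - int i)))"

lemma circ_carrier [simp]: "circ \<epsilon> \<in> carrier_mat N N" "dim_row (circ \<epsilon>) = N" "dim_col (circ \<epsilon>) = N"
  by (simp_all add: circ_def)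

lemma periodic_unit_root_mult: "periodic (\<lambda>m. unit_root (m * d))"
  by (rule periodicI, rule unit_root_cong)
    (metis dvd_mult2 left_diff_distrib mod_eq_dvd_iff)

lemma periodic_circ_entry: "periodic (circ_entry \<epsilon>)"
proof (rule periodicI)
  fix a b assume "a mod int N = b mod int N"
  then have "unit_root (int m * a) = unit_root (int m * b)" for m
    by (intro unit_root_cong) (metis dvd_mult right_diff_distrib mod_eq_dvd_iff)
  then show "circ_entry \<epsilon> a = circ_entry \<epsilon> b" by (simp add: circ_entry_def)
qed

lemma circ_entry_uminus:
  assumes "\<epsilon> \<in> sign_functions"
  shows "circ_entry \<epsilon> (- d) = circ_entry \<epsilon> d"
proof -
  have \<epsilon>: "periodic \<epsilon>" "\<And>m. \<epsilon> (- m) = \<epsilon> m" using assms by (auto simp: sign_functions_def)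
  have "periodic (\<lambda>m. of_real (\<epsilon> m) * unit_root (m * d))"
    using \<epsilon>(1) periodic_unit_root_mult[of d] by (simp add: periodic_def)
  from sum_periodic_reflect[OF this, of 0] show ?thesis
    by (simp add: circ_entry_def \<epsilon>)
qed

text \<open>Conjugation replaces \<open>d\<close> by \<open>- d\<close>, and evenness of
  \<open>\<epsilon>\<close> undoes this, so the transform is real. Entries can then be computed with
  complex exponentials.\<close>

lemma of_real_circ:
  assumes "\<epsilon> \<in> sign_functions" "i < N" "j < N"
  shows "complex_of_real (circ \<epsilon> $$ (i, j)) = circ_entry \<epsilon> (int j - int i)"
proof -
  have "cnj (circ_entry \<epsilon> d) = circ_entry \<epsilon> (- d)" for d
    by (simp add: circ_entry_def cnj_unit_root)
  then have "circ_entry \<epsilon> (int j - int i) \<in> \<real>"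
    using circ_entry_uminus[OF assms(1)] by (simp add: Reals_cnj_iff)
  then show ?thesis using assms by (simp add: circ_def)
qed

lemma sign_functionsD:
  assumes "\<epsilon> \<in> sign_functions"
  shows "periodic \<epsilon>" "\<epsilon> (- m) = \<epsilon> m" "\<epsilon> m = 1 \<or> \<epsilon> m = -1"
  using assms by (simp_all add: sign_functions_def)

lemma mult_sign_functions:
  assumes "\<epsilon> \<in> sign_functions" "\<eta> \<in> sign_functions"
  shows "(\<lambda>m. \<epsilon> m * \<eta> m) \<in> sign_functions"
proof -
  have "\<epsilon> m * \<eta> m = 1 \<or> \<epsilon> m * \<eta> m = -1" for m
    using sign_functionsD(3)[OF assms(1), of m] sign_functionsD(3)[OF assms(2), of m] by auto
  moreover have "periodic (\<lambda>m. \<epsilon> m * \<eta> m)"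
    using assms[THEN sign_functionsD(1)] by (simp add: periodic_def)
  ultimately show ?thesis
    using assms[THEN sign_functionsD(2)] by (simp add: sign_functions_def)
qed

lemma sign_square: "\<epsilon> \<in> sign_functions \<Longrightarrow> \<epsilon> m * \<epsilon> m = 1"
  using sign_functionsD(3)[of \<epsilon> m] by auto

text \<open>The transform turns pointwise products into convolutions: after expanding both factors,
  the sum over \<open>k\<close> is a character sum that forces the two frequencies to agree.\<close>

lemma circ_entry_convolution:
  "(\<Sum>k<N. circ_entry \<epsilon> (int k - a) * circ_entry \<eta> (b - int k)) = circ_entry (\<lambda>m. \<epsilon> m * \<eta> m) (b - a)"
proof -
  have "(\<Sum>k<N. circ_entry \<epsilon> (int k - a) * circ_entry \<eta> (b - int k)) * (of_nat N * of_nat N)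
     = (\<Sum>k<N. (\<Sum>m<N. of_real (\<epsilon> (int m)) * unit_root (int m * (int k - a))) *
           (\<Sum>n<N. of_real (\<eta> (int n)) * unit_root (int n * (b - int k))))"
    unfolding sum_distrib_right[of _ "{..<N}" "of_nat N * of_nat N"] circ_entry_def
    using N_pos by (intro sum.cong refl) simp
  also have "\<dots> = (\<Sum>k<N. \<Sum>m<N. \<Sum>n<N. of_real (\<epsilon> (int m) * \<eta> (int n)) * unit_root (int n * b - int m * a)
        * unit_root (int k * (int m - int n)))"
    unfolding sum_product
    by (intro sum.cong refl) (simp add: unit_root_add[symmetric] algebra_simps)
  also have "\<dots> = (\<Sum>m<N. \<Sum>n<N. \<Sum>k<N. of_real (\<epsilon> (int m) * \<eta> (int n)) * unit_root (int n * b - int m * a)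
        * unit_root (int k * (int m - int n)))"
    by (subst sum.swap) (intro sum.cong refl sum.swap)
  also have "\<dots> = (\<Sum>m<N. \<Sum>n<N. if n = m then of_nat N * (of_real (\<epsilon> (int m) * \<eta> (int m)) * unit_root (int m * (b - a))) else 0)"
  proof (intro sum.cong refl)
    fix m n assume "m \<in> {..<N}" "n \<in> {..<N}"
    then have "(int N dvd int m - int n) = (n = m)"
      by (auto simp: dvd_diff_iff_eq)
    then show "(\<Sum>k<N. of_real (\<epsilon> (int m) * \<eta> (int n)) * unit_root (int n * b - int m * a)
        * unit_root (int k * (int m - int n))) = (if n = m then of_nat N * (of_real (\<epsilon> (int m) * \<eta> (int m)) * unit_root (int m * (b - a))) else 0)"
      unfolding sum_distrib_left[symmetric] sum_unit_root by (simp add: right_diff_distrib)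
  qed
  also have "\<dots> = circ_entry (\<lambda>m. \<epsilon> m * \<eta> m) (b - a) * (of_nat N * of_nat N)"
    using N_pos by (simp add: circ_entry_def sum_distrib_left[symmetric])
  finally show ?thesis using N_pos by simp
qed

lemma circ_mult:
  assumes "\<epsilon> \<in> sign_functions" "\<eta> \<in> sign_functions"
  shows "circ \<epsilon> * circ \<eta> = circ (\<lambda>m. \<epsilon> m * \<eta> m)"
proof (rule eq_matI)
  fix i j assume "i < dim_row (circ (\<lambda>m. \<epsilon> m * \<eta> m))" "j < dim_col (circ (\<lambda>m. \<epsilon> m * \<eta> m))"
  then have ij: "i < N" "j < N" by simp_all
  have "complex_of_real ((circ \<epsilon> * circ \<eta>) $$ (i, j)) = complex_of_real (circ (\<lambda>m. \<epsilon> m * \<eta> m) $$ (i, j))"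
    using ij assms
    by (simp add: scalar_prod_def of_real_circ mult_sign_functions atLeast0LessThan circ_entry_convolution)
  then show "(circ \<epsilon> * circ \<eta>) $$ (i, j) = circ (\<lambda>m. \<epsilon> m * \<eta> m) $$ (i, j)"
    by (simp only: of_real_eq_iff)
qed simp_all

lemma one_sign_function: "(\<lambda>_. 1) \<in> sign_functions"
  by (simp add: sign_functions_def periodic_def)

lemma circ_one: "circ (\<lambda>_. 1) = 1\<^sub>m N"
proof (rule eq_matI)
  fix i j assume "i < dim_row (1\<^sub>m N :: real mat)" "j < dim_col (1\<^sub>m N :: real mat)"
  then have ij: "i < N" "j < N" by simp_all
  then show "circ (\<lambda>_. 1) $$ (i, j) = 1\<^sub>m N $$ (i, j)"
    using N_pos by (simp add: circ_def circ_entry_def sum_unit_root dvd_diff_iff_eq)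
qed simp_all

lemma transpose_circ:
  assumes "\<epsilon> \<in> sign_functions"
  shows "transpose_mat (circ \<epsilon>) = circ \<epsilon>"
proof (rule eq_matI)
  fix i j assume "i < dim_row (circ \<epsilon>)" "j < dim_col (circ \<epsilon>)"
  then show "transpose_mat (circ \<epsilon>) $$ (i, j) = circ \<epsilon> $$ (i, j)"
    using circ_entry_uminus[OF assms, of "int j - int i"] by (simp add: circ_def)
qed simp_all

lemma circ_square: "\<epsilon> \<in> sign_functions \<Longrightarrow> circ \<epsilon> * circ \<epsilon> = 1\<^sub>m N"
  by (simp add: circ_mult sign_square circ_one)

lemma circ_in_circ_symm_orth:
  assumes "\<epsilon> \<in> sign_functions"
  shows "circ \<epsilon> \<in> circ_symm_orth N"
proof -
  have "circulant_mat N (circ \<epsilon>)"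
    unfolding circulant_mat_def
  proof (intro conjI allI impI)
    fix i j k l assume ij: "i < N" "j < N" "k < N" "l < N"
      and "(int j - int i) mod int N = (int l - int k) mod int N"
    from periodic_cong[OF periodic_circ_entry this(5)]
    show "circ \<epsilon> $$ (i, j) = circ \<epsilon> $$ (k, l)"
      using ij by (simp add: circ_def)
  qed simp
  then show ?thesis
    using assms by (simp add: circ_symm_orth_def orthogonal_group_def symm_mat_def transpose_circ circ_square)
qed

section \<open>Fourier inversion and the classification of symmetric circulant orthogonal
  matrices\<close>

text \<open>Both transforms use the exponential with the same sign, so orthogonality returns the
  value at \<open>- m\<close>; evenness of \<open>\<epsilon>\<close> turns it into the value at
  \<open>m\<close>.\<close>

lemma sum_circ_entry_unit_root:
  assumes "\<epsilon> \<in> sign_functions"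
  shows "(\<Sum>d<N. circ_entry \<epsilon> (int d) * unit_root (int d * m)) = of_real (\<epsilon> m)"
proof -
  have "(\<Sum>d<N. circ_entry \<epsilon> (int d) * unit_root (int d * m)) * of_nat N
      = (\<Sum>d<N. \<Sum>n<N. of_real (\<epsilon> (int n)) * unit_root (int d * (int n - (- m))))"
    unfolding sum_distrib_right[of _ "{..<N}" "of_nat N"]
  proof (rule sum.cong, rule refl)
    fix d
    have "circ_entry \<epsilon> (int d) * unit_root (int d * m) * of_nat N
        = (\<Sum>n<N. of_real (\<epsilon> (int n)) * unit_root (int n * int d)) * unit_root (int d * m)"
      using N_pos by (simp add: circ_entry_def)
    also have "\<dots> = (\<Sum>n<N. of_real (\<epsilon> (int n)) * unit_root (int d * (int n - (- m))))"
      by (simp add: sum_distrib_right unit_root_add distrib_left mult.commute[of _ "int d"] mult.assoc)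
    finally show "circ_entry \<epsilon> (int d) * unit_root (int d * m) * of_nat N = \<dots>" .
  qed
  also have "\<dots> = (\<Sum>n<N. of_real (\<epsilon> (int n)) * (\<Sum>d<N. unit_root (int d * (int n - (- m)))))"
    by (subst sum.swap) (simp only: sum_distrib_left)
  also have "\<dots> = (\<Sum>n<N. if int N dvd int n - (- m) then of_real (\<epsilon> (int n)) * of_nat N else 0)"
    unfolding sum_unit_root by (intro sum.cong refl) simp
  also have "\<dots> = of_real (\<epsilon> (- m)) * of_nat N"
    using sign_functionsD(1)[OF assms]
    by (intro sum_periodic_delta[of "\<lambda>n. of_real (\<epsilon> n) * of_nat N"]) (simp add: periodic_def)
  finally show ?thesis using N_pos sign_functionsD(2)[OF assms] by simp
qed

text \<open>Row 0 of the matrix determines \<open>\<epsilon>\<close> by Fourier inversion.\<close>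

lemma inj_on_circ: "inj_on circ sign_functions"
proof (rule inj_onI, rule ext)
  fix \<epsilon> \<eta> m assume *: "\<epsilon> \<in> sign_functions" "\<eta> \<in> sign_functions" "circ \<epsilon> = circ \<eta>"
  have "circ_entry \<epsilon> (int d) = circ_entry \<eta> (int d)" if "d < N" for d
    using of_real_circ[OF *(1) N_pos that] of_real_circ[OF *(2) N_pos that] *(3) by simp
  then have "complex_of_real (\<epsilon> m) = of_real (\<eta> m)"
    using sum_circ_entry_unit_root[OF *(1), of m] sum_circ_entry_unit_root[OF *(2), of m] by simp
  then show "\<epsilon> m = \<eta> m" by simp
qed

text \<open>For the harder inclusion, the transform of row 0 of the matrix is the required sign
  function: symmetry makes it even and real, and \<open>A * A = 1\<^sub>m N\<close> makes its values
  square to 1.\<close>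

lemma circ_symm_orth_eq: "circ_symm_orth N = circ ` sign_functions"
proof
  show "circ ` sign_functions \<subseteq> circ_symm_orth N"
    by (auto intro: circ_in_circ_symm_orth)
  show "circ_symm_orth N \<subseteq> circ ` sign_functions"
  proof
    fix A assume A: "A \<in> circ_symm_orth N"
    then have carrier: "A \<in> carrier_mat N N" and transpose: "transpose_mat A = A"
      and square: "A * A = 1\<^sub>m N" and circulant: "circulant_mat N A"
      by (auto simp: circ_symm_orth_def orthogonal_group_def symm_mat_def)
    \<comment> \<open>Row 0, extended periodically, determines every entry of
      \<open>A\<close>.\<close>
    define a where "a d = A $$ (0, nat (d mod int N))" for d
    have a: "periodic a" by (simp add: periodic_def a_def)
    have A_eq: "A $$ (i, j) = a (int j - int i)" if "i < N" "j < N" for i j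
    proof -
      let ?k = "nat ((int j - int i) mod int N)"
      have "?k < N" "int ?k = (int j - int i) mod int N" using N_pos by (simp_all add: nat_less_iff)
      moreover from this have "(int j - int i) mod int N = (int ?k - int 0) mod int N" by simp
      ultimately show ?thesis
        using circulant that N_pos unfolding circulant_mat_def a_def by blast
    qed
    have a_even: "a (- d) = a d" for d
    proof -
      let ?k = "nat (d mod int N)"
      have k: "?k < N" "int ?k = d mod int N" using N_pos by (simp_all add: nat_less_iff)
      have "A $$ (?k, 0) = transpose_mat A $$ (0, ?k)"
        using carrier k(1) N_pos by simp
      then have "a (- int ?k) = a (int ?k)"
        using A_eq[OF k(1) N_pos] A_eq[OF N_pos k(1)] transpose by simp
      moreover have "a (- int ?k) = a (- d)"
        unfolding k(2) by (rule periodic_cong[OF a]) (rule mod_minus_eq)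
      ultimately show ?thesis using k(2) a by (simp add: periodic_mod)
    qed
    \<comment> \<open>The eigenvalues of \<open>A\<close>, as the Fourier transform of row
      0.\<close>
    define c where "c m = (\<Sum>k<N. of_real (a (int k)) * unit_root (int k * m))" for m
    have c_periodic: "periodic c"
    proof (rule periodicI)
      fix x y assume "x mod int N = y mod int N"
      then have "unit_root (int k * x) = unit_root (int k * y)" for k
        by (intro unit_root_cong) (metis dvd_mult right_diff_distrib mod_eq_dvd_iff)
      then show "c x = c y" by (simp add: c_def)
    qed
    have c_even: "c (- m) = c m" for m
    proof -
      have "periodic (\<lambda>k. of_real (a k) * unit_root (k * m))"
        using a periodic_unit_root_mult[of m] by (simp add: periodic_def)
      from sum_periodic_reflect[OF this, of 0] show ?thesis
        by (simp add: c_def a_even)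
    qed
    have "cnj (c m) = c (- m)" for m by (simp add: c_def cnj_unit_root)
    then have c_real: "of_real (Re (c m)) = c m" for m
      using c_even by (simp add: Reals_cnj_iff)
    \<comment> \<open>This is row 0 of \<open>A * A = 1\<^sub>m N\<close>.\<close>
    have convolution: "(\<Sum>k<N. a (int k) * a (int j - int k)) = (if j = 0 then 1 else 0)" if "j < N" for j
    proof -
      have "(A * A) $$ (0, j) = (\<Sum>k<N. a (int k) * a (int j - int k))"
        using carrier that N_pos
        by (auto simp: scalar_prod_def A_eq atLeast0LessThan)
      then show ?thesis using square that N_pos by simp
    qed
    have c_square: "c m * c m = 1" for m
    proof -
      have "c m * c m = (\<Sum>k<N. \<Sum>l<N. of_real (a (int k)) * (of_real (a (int l)) * unit_root ((int k + int l) * m)))"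
        unfolding c_def sum_product
        by (intro sum.cong refl) (simp add: unit_root_add distrib_right)
      \<comment> \<open>Substituting \<open>j = k + l\<close> modulo \<open>N\<close> exhibits the
        square as the transform of the convolution of \<open>a\<close> with itself, which is the
        indicator of 0.\<close>
      also have "\<dots> = (\<Sum>k<N. \<Sum>j<N. of_real (a (int k)) * (of_real (a (int j - int k)) * unit_root (int j * m)))"
      proof (rule sum.cong, rule refl)
        fix k
        have "periodic (\<lambda>l. unit_root ((int k + l) * m))"
          by (rule periodicI, rule unit_root_cong)
            (metis add_diff_cancel_left dvd_mult2 left_diff_distrib mod_eq_dvd_iff)
        then have "periodic (\<lambda>l. complex_of_real (a (int k)) * (of_real (a l) * unit_root ((int k + l) * m)))"
          using a by (simp add: periodic_def)
        from sum_periodic_shift[OF this, of "- int k"]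
        show "(\<Sum>l<N. complex_of_real (a (int k)) * (of_real (a (int l)) * unit_root ((int k + int l) * m)))
          = (\<Sum>j<N. of_real (a (int k)) * (of_real (a (int j - int k)) * unit_root (int j * m)))"
          by simp
      qed
      also have "\<dots> = (\<Sum>j<N. of_real (\<Sum>k<N. a (int k) * a (int j - int k)) * unit_root (int j * m))"
        by (subst sum.swap) (simp add: sum_distrib_right mult.assoc)
      also have "\<dots> = (\<Sum>j<N. if j = 0 then 1 else 0)"
        by (intro sum.cong refl) (simp add: convolution)
      finally show ?thesis using N_pos by simp
    qed
    have "Re (c m) = 1 \<or> Re (c m) = -1" for m
    proof -
      have "complex_of_real (Re (c m) * Re (c m)) = of_real 1"
        by (simp only: of_real_mult c_real c_square of_real_1)
      then have "Re (c m) * Re (c m) = 1" by (simp only: of_real_eq_iff)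
      then show ?thesis by (simp add: square_eq_1_iff)
    qed
    then have sign: "(\<lambda>m. Re (c m)) \<in> sign_functions"
      using c_periodic c_even by (simp add: sign_functions_def periodic_def)
    have entry: "circ_entry (\<lambda>m. Re (c m)) d = of_real (a d)" for d
    proof -
      have "circ_entry (\<lambda>m. Re (c m)) d * of_nat N = (\<Sum>m<N. c (int m) * unit_root (int m * d))"
        using N_pos by (simp add: circ_entry_def c_real)
      also have "\<dots> = (\<Sum>m<N. \<Sum>k<N. of_real (a (int k)) * unit_root (int m * (int k - (- d))))"
        unfolding c_def sum_distrib_right
        by (intro sum.cong refl) (simp add: unit_root_add distrib_left mult.commute)
      also have "\<dots> = (\<Sum>k<N. of_real (a (int k)) * (\<Sum>m<N. unit_root (int m * (int k - (- d)))))"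
        by (subst sum.swap) (simp only: sum_distrib_left)
      also have "\<dots> = (\<Sum>k<N. if int N dvd int k - (- d) then of_real (a (int k)) * of_nat N else 0)"
        unfolding sum_unit_root by (intro sum.cong refl) simp
      also have "\<dots> = of_real (a (- d)) * of_nat N"
        using a by (intro sum_periodic_delta[of "\<lambda>n. of_real (a n) * of_nat N"]) (simp add: periodic_def)
      finally show ?thesis using N_pos a_even by simp
    qed
    have "A = circ (\<lambda>m. Re (c m))"
      using carrier by (intro eq_matI) (auto simp: circ_def entry A_eq)
    then show "A \<in> circ ` sign_functions" using sign by blast
  qed
qed

section \<open>Invariance and correlations of random signs\<close>

text \<open>A sign function is determined by the set of residues where it equals 1.\<close>

lemma finite_sign_functions: "finite sign_functions"
proof (rule finite_surj[of "Pow {..<N}"])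
  show "sign_functions \<subseteq> (\<lambda>A k. if nat (k mod int N) \<in> A then 1 else -1) ` Pow {..<N}"
  proof
    fix \<epsilon> assume \<epsilon>: "\<epsilon> \<in> sign_functions"
    have "\<epsilon> k = (if nat (k mod int N) \<in> {i. i < N \<and> \<epsilon> (int i) = 1} then 1 else -1)" for k
      using sign_functionsD(3)[OF \<epsilon>, of k] periodic_mod[OF sign_functionsD(1)[OF \<epsilon>], of k] N_pos
      by (auto simp: nat_less_iff)
    then have "\<epsilon> = (\<lambda>A k. if nat (k mod int N) \<in> A then 1 else -1) {i. i < N \<and> \<epsilon> (int i) = 1}"
      by (rule ext)
    then show "\<epsilon> \<in> (\<lambda>A k. if nat (k mod int N) \<in> A then 1 else -1) ` Pow {..<N}"
      by (rule image_eqI) auto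
  qed
qed simp

text \<open>Multiplication by \<open>\<eta>\<close> is an involution of the set, since
  \<open>\<eta>\<close> squares to 1. This invariance serves both to cancel correlations and to
  remove \<open>U\<close> from \<open>U * B\<close>.\<close>

lemma sum_sign_functions_mult:
  fixes F :: "(int \<Rightarrow> real) \<Rightarrow> 'a::comm_monoid_add"
  assumes "\<eta> \<in> sign_functions"
  shows "(\<Sum>\<epsilon>\<in>sign_functions. F (\<lambda>m. \<eta> m * \<epsilon> m)) = (\<Sum>\<epsilon>\<in>sign_functions. F \<epsilon>)"
  by (rule sum.reindex_bij_witness[of _ "\<lambda>\<epsilon> m. \<eta> m * \<epsilon> m" "\<lambda>\<epsilon> m. \<eta> m * \<epsilon> m"])
    (simp_all add: mult_sign_functions assms sign_square flip: mult.assoc)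

text \<open>Flipping the sign at \<open>\<plusminus>m\<close> is a symmetry of the set of sign functions; it negates
  \<open>\<epsilon> m * \<epsilon> n\<close> unless \<open>n \<equiv> \<plusminus>m\<close>.\<close>

lemma sum_sign_functions_correlation:
  "(\<Sum>\<epsilon>\<in>sign_functions. \<epsilon> m * \<epsilon> n) =
    (if int N dvd n - m \<or> int N dvd n + m then real (card sign_functions) else 0)"
proof (cases "int N dvd n - m \<or> int N dvd n + m")
  case True
  have "\<epsilon> m * \<epsilon> n = 1" if \<epsilon>: "\<epsilon> \<in> sign_functions" for \<epsilon>
  proof -
    have "n mod int N = m mod int N \<or> n mod int N = (- m) mod int N"
      using True by (simp add: mod_eq_dvd_iff)
    then have "\<epsilon> n = \<epsilon> m"
      using periodic_cong[OF sign_functionsD(1)[OF \<epsilon>]] sign_functionsD(2)[OF \<epsilon>] by metis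
    then show ?thesis using sign_square[OF \<epsilon>] by simp
  qed
  then show ?thesis using True by simp
next
  case False
  define \<sigma> :: "int \<Rightarrow> real" where "\<sigma> k = (if int N dvd k - m \<or> int N dvd k + m then -1 else 1)" for k
  have "int N dvd k mod int N - m \<longleftrightarrow> int N dvd k - m" "int N dvd k mod int N + m \<longleftrightarrow> int N dvd k + m" for k
    by (simp_all add: dvd_eq_mod_eq_0 mod_simps)
  moreover have "int N dvd - k - m \<longleftrightarrow> int N dvd k + m" "int N dvd - k + m \<longleftrightarrow> int N dvd k - m" for k
    using dvd_minus_iff[of "int N" "k + m"] dvd_minus_iff[of "int N" "k - m"] by (simp_all add: algebra_simps)
  ultimately have \<sigma>: "\<sigma> \<in> sign_functions"
    by (auto simp: sign_functions_def periodic_def \<sigma>_def)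
  have "(\<Sum>\<epsilon>\<in>sign_functions. \<epsilon> m * \<epsilon> n) = (\<Sum>\<epsilon>\<in>sign_functions. (\<sigma> m * \<epsilon> m) * (\<sigma> n * \<epsilon> n))"
    using sum_sign_functions_mult[OF \<sigma>, of "\<lambda>\<epsilon>. \<epsilon> m * \<epsilon> n"] by simp
  also have "\<dots> = - (\<Sum>\<epsilon>\<in>sign_functions. \<epsilon> m * \<epsilon> n)"
    using False by (simp add: \<sigma>_def sum_negf)
  finally show ?thesis using False by simp
qed

section \<open>Second moments of the matrix entries\<close>

text \<open>The selected residues are the fixed points of negation modulo \<open>N\<close>: always
  0, and also \<open>N div 2\<close> when \<open>N\<close> is even.\<close>

lemma sum_half_periods:
  fixes f :: "nat \<Rightarrow> 'a::comm_monoid_add"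
  shows "(\<Sum>k<N. if int N dvd 2 * int k then f k else 0) = f 0 + (if even N then f (N div 2) else 0)"
proof -
  have dvd: "int N dvd 2 * int k \<longleftrightarrow> k = 0 \<or> even N \<and> k = N div 2" if "k < N" for k
  proof
    assume "int N dvd 2 * int k"
    then have "int N dvd int (2 * k)" by simp
    then have "N dvd 2 * k" by (simp only: of_nat_dvd_iff)
    then obtain q where q: "2 * k = N * q" ..
    \<comment> \<open>Since \<open>k < N\<close>, the quotient \<open>q\<close> can only be 0 or 1,
      and 1 forces \<open>N = 2 * k\<close>.\<close>
    have "N * q < N * 2" unfolding q[symmetric] using that by simp
    then have "q < 2" by (simp only: mult_less_cancel1)
    then have "q = 0 \<or> q = 1" by auto
    then show "k = 0 \<or> even N \<and> k = N div 2" using q by auto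
  qed auto
  have "(\<Sum>k<N. if int N dvd 2 * int k then f k else 0) = sum f {k \<in> {..<N}. int N dvd 2 * int k}"
    by (rule sum.inter_filter[symmetric]) simp
  also have "{k \<in> {..<N}. int N dvd 2 * int k} = (if even N then {0, N div 2} else {0})"
    using N_pos by (auto simp: dvd)
  also have "sum f \<dots> = f 0 + (if even N then f (N div 2) else 0)"
    using N_pos by (auto elim!: evenE)
  finally show ?thesis .
qed

text \<open>In the expanded square only the pairs with \<open>n\<close> congruent to
  \<open>m\<close> or \<open>- m\<close> survive. The first kind gives
  \<open>unit_root (m * (2 * d))\<close>, the second gives 1, and pairs of both kinds must be
  counted once. Summing over \<open>m\<close> produces the three terms in the numerator.\<close>

lemma sum_circ_entry_square:
  "(\<Sum>\<epsilon>\<in>sign_functions. (circ_entry \<epsilon> d)\<^sup>2) = of_nat (card sign_functions) *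
     ((if int N dvd 2 * d then of_nat N else 0) + of_nat N - (if even N then 2 else 1)) / (of_nat N)\<^sup>2"
proof -
  let ?c = "of_nat (card sign_functions) :: complex"
  \<comment> \<open>Inclusion-exclusion over the two congruences; they coincide exactly when
    \<open>N\<close> divides \<open>2 * m\<close>.\<close>
  have inner: "(\<Sum>n<N. (if int N dvd int n - m \<or> int N dvd int n + m then unit_root ((m + int n) * d) else 0))
     = unit_root (m * (2 * d)) + 1 - (if int N dvd 2 * m then 1 else 0)" for m
  proof -
    have periodic: "periodic (\<lambda>n. unit_root ((m + n) * d))"
      by (rule periodicI, rule unit_root_cong)
        (metis add_diff_cancel_left dvd_mult2 left_diff_distrib mod_eq_dvd_iff)
    \<comment> \<open>On the overlap the root of unity equals 1, so the correction is a plain 1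
      independent of \<open>d\<close>.\<close>
    have both: "int N dvd 2 * m" "unit_root ((m + n) * d) = 1" if "int N dvd n - m" "int N dvd n + m" for n
    proof -
      show "int N dvd 2 * m" using dvd_diff[OF that(2,1)] by simp
      show "unit_root ((m + n) * d) = 1"
        unfolding unit_root_eq_1_iff by (metis that(2) add.commute dvd_mult2)
    qed
    have one: "int N dvd n + m" if "int N dvd n - m" "int N dvd 2 * m" for n
      using dvd_add[OF that] by (simp add: add.commute[of m])
    have "(\<Sum>n<N. (if int N dvd int n - m \<or> int N dvd int n + m then unit_root ((m + int n) * d) else 0))
      = (\<Sum>n<N. (if int N dvd int n - m then unit_root ((m + int n) * d) else 0)
         + (if int N dvd int n - (- m) then unit_root ((m + int n) * d) else 0)
         - (if int N dvd int n - m then (if int N dvd 2 * m then 1 else 0) else 0))"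
    proof (rule sum.cong, rule refl)
      fix n
      show "(if int N dvd int n - m \<or> int N dvd int n + m then unit_root ((m + int n) * d) else 0)
        = (if int N dvd int n - m then unit_root ((m + int n) * d) else 0)
         + (if int N dvd int n - (- m) then unit_root ((m + int n) * d) else 0)
         - (if int N dvd int n - m then (if int N dvd 2 * m then 1 else 0) else 0)"
        using both[of "int n"] one[of "int n"]
        by (cases "int N dvd int n - m"; cases "int N dvd int n + m") auto
    qed
    also have "\<dots> = unit_root ((m + m) * d) + unit_root ((m + - m) * d) - (if int N dvd 2 * m then 1 else 0)"
      unfolding sum.distrib sum_subtractf
      by (intro arg_cong2[of _ _ _ _ "(+)"] arg_cong2[of _ _ _ _ "(-)"]
          sum_periodic_delta[OF periodic] sum_periodic_delta[of "\<lambda>_. if int N dvd 2 * m then 1 else 0"])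
        (simp add: periodic_def)
    finally show ?thesis by (simp add: algebra_simps)
  qed
  have "(\<Sum>\<epsilon>\<in>sign_functions. (circ_entry \<epsilon> d)\<^sup>2) * (of_nat N)\<^sup>2
    = (\<Sum>\<epsilon>\<in>sign_functions. \<Sum>m<N. \<Sum>n<N. of_real (\<epsilon> (int m) * \<epsilon> (int n)) * unit_root ((int m + int n) * d))"
    unfolding sum_distrib_right[of _ sign_functions]
  proof (intro sum.cong refl)
    fix \<epsilon>
    have "(circ_entry \<epsilon> d)\<^sup>2 * (of_nat N)\<^sup>2 = (\<Sum>m<N. of_real (\<epsilon> (int m)) * unit_root (int m * d))\<^sup>2"
      using N_pos by (simp add: circ_entry_def power_divide)
    also have "\<dots> = (\<Sum>m<N. \<Sum>n<N. of_real (\<epsilon> (int m) * \<epsilon> (int n)) * unit_root ((int m + int n) * d))"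
      unfolding power2_eq_square sum_product
      by (intro sum.cong refl) (simp add: unit_root_add distrib_right)
    finally show "(circ_entry \<epsilon> d)\<^sup>2 * (of_nat N)\<^sup>2 = \<dots>" .
  qed
  also have "\<dots> = (\<Sum>m<N. \<Sum>n<N. \<Sum>\<epsilon>\<in>sign_functions. of_real (\<epsilon> (int m) * \<epsilon> (int n)) * unit_root ((int m + int n) * d))"
    by (subst sum.swap) (intro sum.cong refl sum.swap)
  also have "\<dots> = (\<Sum>m<N. \<Sum>n<N. of_real (\<Sum>\<epsilon>\<in>sign_functions. \<epsilon> (int m) * \<epsilon> (int n)) * unit_root ((int m + int n) * d))"
    by (simp add: sum_distrib_right)
  also have "\<dots> = (\<Sum>m<N. ?c * (\<Sum>n<N. (if int N dvd int n - int m \<or> int N dvd int n + int m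
       then unit_root ((int m + int n) * d) else 0)))"
    unfolding sum_sign_functions_correlation sum_distrib_left
    by (intro sum.cong refl) simp
  also have "\<dots> = ?c * ((\<Sum>m<N. unit_root (int m * (2 * d))) + of_nat N - (\<Sum>m<N. if int N dvd 2 * int m then 1 else 0))"
    unfolding inner by (simp add: sum_distrib_left[symmetric] sum.distrib sum_subtractf)
  also have "\<dots> = ?c * ((if int N dvd 2 * d then of_nat N else 0) + of_nat N - (if even N then 2 else 1))"
    unfolding sum_unit_root sum_half_periods by simp
  finally show ?thesis using N_pos by (simp add: eq_divide_eq)
qed

lemma sum_circ_square:
  assumes "i < N" "j < N"
  shows "(\<Sum>\<epsilon>\<in>sign_functions. (circ \<epsilon> $$ (i, j))\<^sup>2) = real (card sign_functions) *
     ((if int N dvd 2 * (int j - int i) then real N else 0) + real N - (if even N then 2 else 1)) / (real N)\<^sup>2"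
    (is "?l = ?r")
proof -
  have "complex_of_real ?l = (\<Sum>\<epsilon>\<in>sign_functions. (circ_entry \<epsilon> (int j - int i))\<^sup>2)"
    by (simp add: of_real_circ assms)
  also have "\<dots> = complex_of_real ?r"
    unfolding sum_circ_entry_square by simp
  finally show ?thesis by (simp only: of_real_eq_iff)
qed

section \<open>Averages over the group and over circulant index pairs\<close>

lemma card_sign_functions_pos: "card sign_functions > 0"
  using one_sign_function finite_sign_functions by (auto simp: card_gt_0_iff)

text \<open>The bijection \<open>circ\<close> carries the uniform measure on sign functions to the
  uniform measure on matrices.\<close>

lemma expectation_circ_symm_orth:
  fixes f :: "real mat \<Rightarrow> 'b::{banach, second_countable_topology}"
  shows "measure_pmf.expectation (pmf_of_set (circ_symm_orth N)) f =
    (\<Sum>\<epsilon>\<in>sign_functions. f (circ \<epsilon>)) /\<^sub>R real (card sign_functions)"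
proof -
  have fin: "finite (circ ` sign_functions)" "circ ` sign_functions \<noteq> {}"
    using finite_sign_functions one_sign_function by auto
  have "measure_pmf.expectation (pmf_of_set (circ ` sign_functions)) f =
      (\<Sum>B\<in>circ ` sign_functions. pmf (pmf_of_set (circ ` sign_functions)) B *\<^sub>R f B)"
    using fin by (intro integral_measure_pmf) auto
  also have "\<dots> = (\<Sum>B\<in>circ ` sign_functions. f B /\<^sub>R real (card sign_functions))"
    using fin by (intro sum.cong refl) (simp add: card_image[OF inj_on_circ] inverse_eq_divide)
  also have "\<dots> = (\<Sum>\<epsilon>\<in>sign_functions. f (circ \<epsilon>)) /\<^sub>R real (card sign_functions)"
    by (simp add: sum.reindex[OF inj_on_circ] scaleR_sum_right)
  finally show ?thesis by (simp add: circ_symm_orth_eq)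
qed

text \<open>Every row is a cyclic shift of row 0, so all row sums agree.\<close>

lemma sum_circulant:
  fixes f :: "int \<Rightarrow> real"
  assumes "periodic f"
  shows "(\<Sum>i<N. \<Sum>j<N. f (int j - int i)) = real N * (\<Sum>k<N. f (int k))"
  using sum_periodic_shift[OF assms, of "- int _"] by simp

end

section \<open>The functional on real matrices\<close>

lemma index_mat_adjoint:
  "i < dim_col A \<Longrightarrow> j < dim_row A \<Longrightarrow> mat_adjoint A $$ (i, j) = conjugate (A $$ (j, i))"
  by (simp add: mat_adjoint_def mat_of_rows_def)

text \<open>For real \<open>U\<close> the phases are signs. Since \<open>B * B\<close> is the
  identity, the trace is that of \<open>X\<close>, where each sign turns its entry of
  \<open>U\<close> into an absolute value; in the second term the signs disappear on
  squaring.\<close>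

lemma Phi_of_real:
  assumes U: "U \<in> carrier_mat N N" and B: "B \<in> carrier_mat N N" and square: "B * B = 1\<^sub>m N"
    and nonzero: "\<And>i j. i < N \<Longrightarrow> j < N \<Longrightarrow> U $$ (i, j) \<noteq> 0"
  shows "Phi (map_mat complex_of_real U) (map_mat complex_of_real B) =
    complex_of_real ((\<Sum>i<N. \<Sum>j<N. \<bar>U $$ (i, j)\<bar>) - (\<Sum>i<N. \<Sum>j<N. ((U * B) $$ (i, j))\<^sup>2 / \<bar>U $$ (i, j)\<bar>))"
proof -
  let ?U = "map_mat complex_of_real U" and ?B = "map_mat complex_of_real B"
  let ?S = "phase_mat ?U"
  let ?X = "mat_adjoint ?S * ?U"
  have S: "?S $$ (i, j) = of_real (U $$ (i, j) / \<bar>U $$ (i, j)\<bar>)" if "i < N" "j < N" for i j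
    using that U by (simp add: phase_mat_def)
  have dim: "dim_row ?S = N" "dim_col ?S = N" "dim_row U = N" "dim_col U = N"
    using U by (simp_all add: phase_mat_def)
  have adjoint: "mat_adjoint ?S \<in> carrier_mat N N"
    using dim by (intro carrier_matI) (simp_all add: mat_adjoint_def)
  then have X: "?X \<in> carrier_mat N N" using U by simp
  have "?B * ?B = 1\<^sub>m N"
    using of_real_hom.mat_hom_mult[OF B B, where 'a = complex] square
    by (simp add: of_real_hom.mat_hom_one)
  then have "mat_trace (?X * (?B * ?B)) = (\<Sum>i<N. ?X $$ (i, i))"
    using X by (simp add: mat_trace_def dim carrier_matD[OF adjoint])
  also have "\<dots> = (\<Sum>i<N. \<Sum>k<N. of_real \<bar>U $$ (k, i)\<bar>)"
  proof (rule sum.cong, rule refl)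
    fix i assume "i \<in> {..<N}"
    then have i: "i < N" by simp
    have "?X $$ (i, i) = (\<Sum>k<N. mat_adjoint ?S $$ (i, k) * ?U $$ (k, i))"
      using i adjoint dim by (auto simp: scalar_prod_def atLeast0LessThan)
    also have "\<dots> = (\<Sum>k<N. of_real \<bar>U $$ (k, i)\<bar>)"
    proof (rule sum.cong, rule refl)
      fix k assume "k \<in> {..<N}"
      then have k: "k < N" by simp
      have "mat_adjoint ?S $$ (i, k) * ?U $$ (k, i) = of_real (U $$ (k, i) / \<bar>U $$ (k, i)\<bar> * U $$ (k, i))"
        using i k dim by (simp add: index_mat_adjoint S)
      also have "U $$ (k, i) / \<bar>U $$ (k, i)\<bar> * U $$ (k, i) = \<bar>U $$ (k, i)\<bar>"
        using nonzero[OF k i] by (simp add: abs_if)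
      finally show "mat_adjoint ?S $$ (i, k) * ?U $$ (k, i) = of_real \<bar>U $$ (k, i)\<bar>" .
    qed
    finally show "?X $$ (i, i) = (\<Sum>k<N. of_real \<bar>U $$ (k, i)\<bar>)" .
  qed
  also have "\<dots> = of_real (\<Sum>i<N. \<Sum>j<N. \<bar>U $$ (i, j)\<bar>)"
    by (subst sum.swap) simp
  finally have trace: "mat_trace (?X * (?B * ?B)) = of_real (\<Sum>i<N. \<Sum>j<N. \<bar>U $$ (i, j)\<bar>)" .
  have "(Re ((?U * ?B) $$ (i, j) * cnj (?S $$ (i, j))))\<^sup>2 / cmod (?U $$ (i, j)) =
      ((U * B) $$ (i, j))\<^sup>2 / \<bar>U $$ (i, j)\<bar>" if "i < N" "j < N" for i j
  proof -
    have "(?U * ?B) $$ (i, j) = of_real ((U * B) $$ (i, j))"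
      using that U B by (simp flip: of_real_hom.mat_hom_mult[OF U B])
    then have "Re ((?U * ?B) $$ (i, j) * cnj (?S $$ (i, j))) = (U * B) $$ (i, j) * (U $$ (i, j) / \<bar>U $$ (i, j)\<bar>)"
      by (simp add: S that)
    then show ?thesis
      using nonzero[OF that] that dim by (simp add: power_mult_distrib power_divide)
  qed
  then have "(\<Sum>i<N. \<Sum>j<N. (Re ((?U * ?B) $$ (i, j) * cnj (?S $$ (i, j))))\<^sup>2 / cmod (?U $$ (i, j))) =
      (\<Sum>i<N. \<Sum>j<N. ((U * B) $$ (i, j))\<^sup>2 / \<bar>U $$ (i, j)\<bar>)"
    by (intro sum.cong refl) simp
  with trace show ?thesis
    by (simp only: Phi_def Let_def index_map_mat dim of_real_diff)
qed

section \<open>Evaluation of the expectation\<close>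

theorem theorem7p6:
  fixes N :: nat and U :: "real mat" and \<gamma> :: "nat \<Rightarrow> real" and e :: nat
  assumes "N \<ge> 1"
    and "U \<in> orthogonal_group N"
    and "circulant_mat N U"
    and "symm_mat U"
    and "\<And>i j. i < N \<Longrightarrow> j < N \<Longrightarrow> U $$ (i, j) \<noteq> 0"
    and "\<And>i j. i < N \<Longrightarrow> j < N \<Longrightarrow>
           U $$ (i, j) = \<gamma> (nat ((int j - int i) mod int N))"
    and "e = (if odd N then 1 else 0)"
  shows "measure_pmf.expectation (pmf_of_set (circ_symm_orth N))
           (\<lambda>B. Phi (map_mat complex_of_real U) (map_mat complex_of_real B)) =
         complex_of_real
           (real N * (\<Sum>i<N. \<bar>\<gamma> i\<bar>) -
            (1 / \<bar>\<gamma> 0\<bar> + (1 - real e) / \<bar>\<gamma> (N div 2)\<bar> +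
             (real N - 2 + real e) / real N * (\<Sum>i<N. 1 / \<bar>\<gamma> i\<bar>)))"
proof -
  have N: "N > 0" using assms(1) by simp
  let ?S = "sign_functions N"
  let ?c = "real (card ?S)"
  \<comment> \<open>The mean of the squared entry of a random matrix of the group at column minus
    row equal to \<open>d\<close>, as computed in \<open>sum_circ_square\<close>.\<close>
  define h where "h d = ((if int N dvd 2 * d then real N else 0) + real N - (if even N then 2 else 1)) / (real N)\<^sup>2" for d
  define g where "g d = \<gamma> (nat (d mod int N))" for d
  have U: "U \<in> carrier_mat N N" using assms(2) by (simp add: orthogonal_group_def)
  have U_eq: "U $$ (i, j) = g (int j - int i)" if "i < N" "j < N" for i j
    using assms(6)[OF that] by (simp add: g_def)
  have g: "g (int k) = \<gamma> k" if "k < N" for k using that by (simp add: g_def)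
  have g_periodic: "g (d mod int N) = g d" for d by (simp add: g_def)
  have h_periodic: "h (d mod int N) = h d" for d
  proof -
    have "int N dvd 2 * (d mod int N) \<longleftrightarrow> int N dvd 2 * d"
      by (simp add: dvd_eq_mod_eq_0 mod_simps)
    then show ?thesis by (simp add: h_def)
  qed
  have "U \<in> circ_symm_orth N" using assms(2-4) by (simp add: circ_symm_orth_def)
  \<comment> \<open>\<open>U\<close> belongs to the same group, so multiplying by it only multiplies
    the random sign function by the fixed \<open>u\<close>.\<close>
  then obtain u where u: "u \<in> ?S" "U = circ N u" using circ_symm_orth_eq[OF N] by blast
  have c: "?c > 0" using card_sign_functions_pos[OF N] by simp
  have second: "(\<Sum>\<epsilon>\<in>?S. ((U * circ N \<epsilon>) $$ (i, j))\<^sup>2) = ?c * h (int j - int i)" if "i < N" "j < N" for i j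
  proof -
    have "(\<Sum>\<epsilon>\<in>?S. ((U * circ N \<epsilon>) $$ (i, j))\<^sup>2) = (\<Sum>\<epsilon>\<in>?S. (circ N (\<lambda>m. u m * \<epsilon> m) $$ (i, j))\<^sup>2)"
      by (intro sum.cong refl) (simp add: u circ_mult[OF N])
    also have "\<dots> = (\<Sum>\<epsilon>\<in>?S. (circ N \<epsilon> $$ (i, j))\<^sup>2)"
      using sum_sign_functions_mult[OF N u(1), of "\<lambda>\<epsilon>. (circ N \<epsilon> $$ (i, j))\<^sup>2"] .
    finally show ?thesis by (simp add: sum_circ_square[OF N that] h_def)
  qed
  have trace: "(\<Sum>i<N. \<Sum>j<N. \<bar>U $$ (i, j)\<bar>) = real N * (\<Sum>k<N. \<bar>\<gamma> k\<bar>)"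
  proof -
    have "(\<Sum>i<N. \<Sum>j<N. \<bar>U $$ (i, j)\<bar>) = (\<Sum>i<N. \<Sum>j<N. \<bar>g (int j - int i)\<bar>)"
      by (intro sum.cong refl) (simp add: U_eq)
    also have "\<dots> = real N * (\<Sum>k<N. \<bar>g (int k)\<bar>)"
      by (rule sum_circulant[OF N]) (simp add: periodic_def[OF N] g_periodic)
    finally show ?thesis by (simp add: g)
  qed
  have quadratic: "(\<Sum>i<N. \<Sum>j<N. h (int j - int i) / \<bar>U $$ (i, j)\<bar>) =
      1 / \<bar>\<gamma> 0\<bar> + (1 - real e) / \<bar>\<gamma> (N div 2)\<bar> + (real N - 2 + real e) / real N * (\<Sum>i<N. 1 / \<bar>\<gamma> i\<bar>)"
  proof -
    have "(\<Sum>i<N. \<Sum>j<N. h (int j - int i) / \<bar>U $$ (i, j)\<bar>) = (\<Sum>i<N. \<Sum>j<N. h (int j - int i) / \<bar>g (int j - int i)\<bar>)"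
      by (intro sum.cong refl) (simp add: U_eq)
    also have "\<dots> = real N * (\<Sum>k<N. h (int k) / \<bar>g (int k)\<bar>)"
      by (rule sum_circulant[OF N]) (simp add: periodic_def[OF N] g_periodic h_periodic)
    also have "\<dots> = (\<Sum>k<N. (if int N dvd 2 * int k then 1 / \<bar>\<gamma> k\<bar> else 0)
        + (real N - 2 + real e) / real N * (1 / \<bar>\<gamma> k\<bar>))"
      unfolding sum_distrib_left
    proof (rule sum.cong, rule refl)
      fix k assume "k \<in> {..<N}"
      then have k: "g (int k) = \<gamma> k" by (simp add: g)
      \<comment> \<open>The number of fixed points of negation, 2 or 1 by parity, is
        \<open>2 - e\<close>. The remaining indicator singles out those fixed points as indices of
        \<open>\<gamma>\<close>.\<close>
      have "real N * h (int k) = (if int N dvd 2 * int k then 1 else 0) + (real N - 2 + real e) / real N"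
        using N assms(7) by (simp add: h_def power2_eq_square field_simps)
      then have "real N * (h (int k) / \<bar>g (int k)\<bar>)
        = ((if int N dvd 2 * int k then 1 else 0) + (real N - 2 + real e) / real N) / \<bar>\<gamma> k\<bar>"
        by (simp add: k)
      then show "real N * (h (int k) / \<bar>g (int k)\<bar>) = (if int N dvd 2 * int k then 1 / \<bar>\<gamma> k\<bar> else 0)
        + (real N - 2 + real e) / real N * (1 / \<bar>\<gamma> k\<bar>)"
        by (simp add: add_divide_distrib)
    qed
    \<comment> \<open>For odd \<open>N\<close> the factor \<open>1 - e\<close> is 0, which removes
      the term at \<open>N div 2\<close>.\<close>
    also have "\<dots> = 1 / \<bar>\<gamma> 0\<bar> + (1 - real e) / \<bar>\<gamma> (N div 2)\<bar> + (real N - 2 + real e) / real N * (\<Sum>i<N. 1 / \<bar>\<gamma> i\<bar>)"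
      unfolding sum.distrib sum_half_periods[OF N] sum_distrib_left[symmetric] using assms(7) by simp
    finally show ?thesis .
  qed
  have "(\<Sum>\<epsilon>\<in>?S. Phi (map_mat complex_of_real U) (map_mat complex_of_real (circ N \<epsilon>))) =
      (\<Sum>\<epsilon>\<in>?S. complex_of_real ((\<Sum>i<N. \<Sum>j<N. \<bar>U $$ (i, j)\<bar>) -
        (\<Sum>i<N. \<Sum>j<N. ((U * circ N \<epsilon>) $$ (i, j))\<^sup>2 / \<bar>U $$ (i, j)\<bar>)))"
    by (intro sum.cong[OF refl] Phi_of_real U circ_carrier[OF N] circ_square[OF N] assms(5))
  also have "\<dots> = complex_of_real (?c * (\<Sum>i<N. \<Sum>j<N. \<bar>U $$ (i, j)\<bar>) -
        (\<Sum>\<epsilon>\<in>?S. \<Sum>i<N. \<Sum>j<N. ((U * circ N \<epsilon>) $$ (i, j))\<^sup>2 / \<bar>U $$ (i, j)\<bar>))"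
    unfolding of_real_sum[symmetric] sum_subtractf by simp
  \<comment> \<open>The sum over signs moves innermost, so that the second moment of each single
    entry of \<open>U * B\<close> can be inserted.\<close>
  also have "(\<Sum>\<epsilon>\<in>?S. \<Sum>i<N. \<Sum>j<N. ((U * circ N \<epsilon>) $$ (i, j))\<^sup>2 / \<bar>U $$ (i, j)\<bar>) =
      (\<Sum>i<N. \<Sum>j<N. \<Sum>\<epsilon>\<in>?S. ((U * circ N \<epsilon>) $$ (i, j))\<^sup>2 / \<bar>U $$ (i, j)\<bar>)"
    by (subst sum.swap) (intro sum.cong refl sum.swap)
  also have "\<dots> = (\<Sum>i<N. \<Sum>j<N. ?c * (h (int j - int i) / \<bar>U $$ (i, j)\<bar>))"
    by (intro sum.cong refl) (simp add: sum_divide_distrib[symmetric] second)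
  also have "\<dots> = ?c * (\<Sum>i<N. \<Sum>j<N. h (int j - int i) / \<bar>U $$ (i, j)\<bar>)"
    by (simp only: sum_distrib_left)
  finally have "(\<Sum>\<epsilon>\<in>?S. Phi (map_mat complex_of_real U) (map_mat complex_of_real (circ N \<epsilon>))) =
      ?c *\<^sub>R complex_of_real ((\<Sum>i<N. \<Sum>j<N. \<bar>U $$ (i, j)\<bar>) - (\<Sum>i<N. \<Sum>j<N. h (int j - int i) / \<bar>U $$ (i, j)\<bar>))"
    unfolding scaleR_conv_of_real of_real_mult[symmetric] right_diff_distrib .
  then show ?thesis
    using c unfolding expectation_circ_symm_orth[OF N] trace quadratic by simp
qed

end
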